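(* Let $M=\begin{pmatrix} a&b\\c&d\end{pmatrix}\in GL(2,\mathbb Z)$. For $(x,y)\in\mathbb Z^2$ let $\operatorname{Orb}_M(x,y)=\{M^n\binom xy:n\in\mathbb Z\}$. Then the linear span $\langle\operatorname{Orb}_M(x,y)\rangle$ equals $\mathbb Z^2$ if and only if $$f_M(y,-x)=\pm1.$$ More generally, $$\min\Big\{k:\exists\,\{(x_j,y_j)\}_{j=1}^k\subset\mathbb Z^2\ \Big|\ \bigcup_{j=1}^k\langle\operatorname{Orb}_M(x_j,y_j)\rangle=\mathbb Z^2\Big\}\ \ge\ \min_{(x,y)\in\mathbb Z^2\setminus\{(0,0)\}}|f_M(x,y)|.$$
   Context: $f_M(x,y)=bx^2-(a-d)xy-cy^2$ is the quadratic form associated with $M$. The linear span $\langle\cdot\rangle$ of a subset of $\mathbb Z^2$ is the subgroup of $\mathbb Z^2$ it generates (integer linear combinations). The minimum of the empty set is $+\infty$. *)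

theory Defs
  imports
    "HOL-Analysis.Analysis"
    "HOL-Computational_Algebra.Group_Closure"
    "HOL-Library.Extended_Nat"
begin

(* The class operation ^ on the vector type acts componentwise, so powers of a matrix
   are written out as iterated matrix products. *)
definition matrix_int_power :: "int^2^2 \<Rightarrow> int \<Rightarrow> int^2^2" where
  "matrix_int_power M n =
     (if 0 \<le> n then ((\<lambda>A. M ** A) ^^ nat n) (mat 1)
      else ((\<lambda>A. matrix_inv M ** A) ^^ nat (- n)) (mat 1))"

definition matrix_orbit :: "int^2^2 \<Rightarrow> int^2 \<Rightarrow> (int^2) set" where
  "matrix_orbit M v = {matrix_int_power M n *v v | n. True}"

(* For M with rows (a, b) and (c, d) this is b x^2 - (a - d) x y - c y^2. *)
definition quad_form :: "int^2^2 \<Rightarrow> int \<Rightarrow> int \<Rightarrow> int" where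
  "quad_form M x y = M$1$2 * x^2 - (M$1$1 - M$2$2) * x * y - M$2$1 * y^2"

(* The union is set-theoretic. An infimum in enat is the least element of a nonempty set,
   and is infinity for the empty set. *)
definition orbit_covering_number :: "int^2^2 \<Rightarrow> enat" where
  "orbit_covering_number M =
     Inf {enat k | k. \<exists>x y :: nat \<Rightarrow> int.
            (\<Union>j\<in>{1..k}. group_closure (matrix_orbit M (vector [x j, y j]))) = UNIV}"

end

theory Submission
  imports Defs
begin

text \<open>
  By Cayley--Hamilton, and because \<open>det M\<close> is a unit, the span of the orbit of \<open>v\<close> is spanned by
  \<open>v\<close> and \<open>M v\<close>, whose determinant is \<open>- f\<^sub>M (y, - x)\<close> for \<open>v = (x, y)\<close>. A sublattice of
  determinant \<open>D\<close> contains at most \<open>N\<^sup>2 / \<bar>D\<bar>\<close> points of \<open>{0..<N}\<^sup>2\<close> whenever \<open>D\<close> divides \<open>N\<close>.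
  So if all the nonzero values of \<open>\<bar>f\<^sub>M\<bar>\<close> exceed \<open>k\<close>, then \<open>k\<close> spans cannot cover such a square.
\<close>

section \<open>Subgroups of Z^2 generated by two vectors\<close>

definition int_lattice :: "int^2 \<Rightarrow> int^2 \<Rightarrow> (int^2) set" where
  "int_lattice v w = {p *s v + q *s w | p q. True}"

lemma int_lattice_iff:
  "u \<in> int_lattice v w \<longleftrightarrow>
     (\<exists>p q. u$1 = p * v$1 + q * w$1 \<and> u$2 = p * v$2 + q * w$2)"
  by (auto simp: int_lattice_def vec_eq_iff forall_2)

lemma int_latticeI: "p *s v + q *s w \<in> int_lattice v w"
  by (auto simp: int_lattice_def)

lemma int_lattice_base: "v \<in> int_lattice v w" "w \<in> int_lattice v w"
  using int_latticeI[of 1 v 0 w] int_latticeI[of 0 v 1 w] by simp_all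

lemma int_lattice_diff:
  assumes "s \<in> int_lattice v w" "t \<in> int_lattice v w"
  shows "s - t \<in> int_lattice v w"
proof -
  obtain p q p' q' where "s = p *s v + q *s w" "t = p' *s v + q' *s w"
    using assms by (auto simp: int_lattice_def)
  then have "s - t = (p - p') *s v + (q - q') *s w"
    by (simp add: vec_eq_iff algebra_simps)
  then show ?thesis by (simp only: int_latticeI)
qed

lemma group_closure_scale:
  fixes v :: "int^'n"
  assumes "v \<in> group_closure S"
  shows "c *s v \<in> group_closure S"
proof -
  have nat: "int n *s v \<in> group_closure S" for n
  proof (induction n)
    case (Suc n)
    have "int (Suc n) *s v = v + int n *s v"
      by (simp add: vec_eq_iff algebra_simps)
    with Suc assms show ?case by (simp add: group_closure_add)
  qed simp
  show ?thesis
  proof (cases "c \<ge> 0")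
    case True
    with nat[of "nat c"] show ?thesis by simp
  next
    case False
    then have "c *s v = - (int (nat (- c)) *s v)" by (simp add: vec_eq_iff)
    with nat[of "nat (- c)"] show ?thesis by simp
  qed
qed

lemma group_closure_eq_int_lattice:
  assumes "v \<in> S" "w \<in> S" "S \<subseteq> int_lattice v w"
  shows "group_closure S = int_lattice v w"
proof
  show "group_closure S \<subseteq> int_lattice v w"
  proof
    fix u assume "u \<in> group_closure S"
    then show "u \<in> int_lattice v w"
    proof induction
      \<comment> \<open>The base rule also admits 0, which is the trivial combination.\<close>
      case (base s)
      then show ?case
        using assms(3) int_latticeI[of 0 v 0 w] by auto
    qed (rule int_lattice_diff)
  qed
  show "int_lattice v w \<subseteq> group_closure S"
    using assms(1,2)
    by (auto simp: int_lattice_def intro!: group_closure_add group_closure_scale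
        intro: group_closure.base)
qed

lemma int_lattice_mult_closed:
  fixes A :: "int^2^2"
  assumes "A *v v \<in> int_lattice v w" "A *v w \<in> int_lattice v w"
    and "u \<in> int_lattice v w"
  shows "A *v u \<in> int_lattice v w"
proof -
  obtain p q where u: "u = p *s v + q *s w"
    using assms(3) by (auto simp: int_lattice_def)
  obtain p1 q1 where v: "A *v v = p1 *s v + q1 *s w"
    using assms(1) by (auto simp: int_lattice_def)
  obtain p2 q2 where w: "A *v w = p2 *s v + q2 *s w"
    using assms(2) by (auto simp: int_lattice_def)
  have "A *v u = p *s (A *v v) + q *s (A *v w)"
    by (simp add: u matrix_vector_mult_def vec_eq_iff sum_2 algebra_simps)
  also have "\<dots> = (p * p1 + q * p2) *s v + (p * q1 + q * q2) *s w"
    by (simp add: v w vec_eq_iff algebra_simps)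
  finally show ?thesis by (simp only: int_latticeI)
qed

lemma iterated_mult_closed:
  fixes A :: "int^2^2"
  assumes "\<And>u. u \<in> L \<Longrightarrow> A *v u \<in> L" "v \<in> L"
  shows "((\<lambda>X. A ** X) ^^ n) (mat 1) *v v \<in> L"
  by (induction n) (simp_all add: assms flip: matrix_vector_mul_assoc)

section \<open>The span of an orbit\<close>

lemma cayley_hamilton_2:
  fixes M :: "int^2^2"
  shows "M *v (M *v v) = (M$1$1 + M$2$2) *s (M *v v) - det M *s v"
  by (simp add: matrix_vector_mult_def vec_eq_iff forall_2 sum_2 det_2 algebra_simps)

text \<open>Applying the inverse to Cayley-Hamilton gives M = t - d * M^(-1), with t the trace and d
  the determinant. Since d is a unit of the integers, it is its own inverse, so multiplying by d
  solves for M^(-1) without division.\<close>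

lemma matrix_inv_2_mult:
  fixes M :: "int^2^2"
  assumes "invertible M"
  shows "matrix_inv M *v v = (det M * (M$1$1 + M$2$2)) *s v - det M *s (M *v v)"
proof -
  let ?P = "matrix_inv M" and ?t = "M$1$1 + M$2$2" and ?d = "det M"
  have MP: "M ** ?P = mat 1" and PM: "?P ** M = mat 1"
    using someI_ex[OF assms[unfolded invertible_def]] by (auto simp: matrix_inv_def)
  have "?d * det ?P = 1"
    using arg_cong[OF MP, of det] by (simp add: det_mul)
  then have d: "?d * ?d = 1"
    by (metis abs_one abs_zmult_eq_1 abs_mult_self_eq mult_1)
  have Pinv: "?P *v (M *v u) = u" for u
    by (simp add: matrix_vector_mul_assoc PM)
  have "M *v v = ?P *v (?t *s (M *v v) - ?d *s v)"
    by (metis Pinv cayley_hamilton_2)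
  also have "\<dots> = ?t *s (?P *v (M *v v)) - ?d *s (?P *v v)"
    by (simp add: matrix_vector_mult_def vec_eq_iff sum_2 algebra_simps)
  finally have "?d *s (M *v v) = ?d *s (?t *s v - ?d *s (?P *v v))"
    by (simp add: Pinv)
  moreover have "?d * (?d * x) = x" for x
    using d by (simp flip: mult.assoc)
  ultimately show ?thesis
    by (simp add: vec_eq_iff algebra_simps)
qed

text \<open>The generators are the powers 0 and 1 applied to \<open>v\<close>. For the other powers
  it suffices that the lattice is invariant under both \<open>M\<close> and its inverse, because the
  orbit runs in both directions; each invariance is checked on the two generators only.\<close>

lemma group_closure_matrix_orbit:
  assumes "invertible M"
  shows "group_closure (matrix_orbit M v) = int_lattice v (M *v v)"
proof (rule group_closure_eq_int_lattice)
  have "matrix_int_power M 0 *v v = v" "matrix_int_power M 1 *v v = M *v v"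
    by (simp_all add: matrix_int_power_def)
  then show "v \<in> matrix_orbit M v" "M *v v \<in> matrix_orbit M v"
    unfolding matrix_orbit_def by (metis (mono_tags, lifting) mem_Collect_eq)+
  let ?L = "int_lattice v (M *v v)"
  have "M *v (M *v v) \<in> ?L"
  proof -
    have "M *v (M *v v) = (- det M) *s v + (M$1$1 + M$2$2) *s (M *v v)"
      by (simp add: cayley_hamilton_2 vec_eq_iff)
    then show ?thesis by (simp only: int_latticeI)
  qed
  then have M: "M *v u \<in> ?L" if "u \<in> ?L" for u
    using int_lattice_mult_closed[OF int_lattice_base(2) _ that] by blast
  have "matrix_inv M *v v \<in> ?L"
  proof -
    have "matrix_inv M *v v = (det M * (M$1$1 + M$2$2)) *s v + (- det M) *s (M *v v)"
      by (simp add: matrix_inv_2_mult[OF assms] vec_eq_iff)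
    then show ?thesis by (simp only: int_latticeI)
  qed
  moreover have "matrix_inv M *v (M *v v) = v"
    using someI_ex[OF assms[unfolded invertible_def]]
    by (simp add: matrix_inv_def matrix_vector_mul_assoc)
  ultimately have P: "matrix_inv M *v u \<in> ?L" if "u \<in> ?L" for u
    using int_lattice_mult_closed[OF _ _ that] int_lattice_base(1) by metis
  show "matrix_orbit M v \<subseteq> ?L"
    by (auto simp: matrix_orbit_def matrix_int_power_def
        intro!: iterated_mult_closed M P int_lattice_base)
qed

section \<open>Determinants and point counts of these subgroups\<close>

lemma int_lattice_eq_UNIV_iff:
  "int_lattice v w = UNIV \<longleftrightarrow> \<bar>v$1 * w$2 - v$2 * w$1\<bar> = 1"
    (is "_ \<longleftrightarrow> \<bar>?D\<bar> = 1")
proof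
  assume "int_lattice v w = UNIV"
  then have "vector [1, 0] \<in> int_lattice v w" "vector [0, 1] \<in> int_lattice v w"
    by simp_all
  then obtain p q p' q' where
    "1 = p * v$1 + q * w$1" "0 = p * v$2 + q * w$2"
    "0 = p' * v$1 + q' * w$1" "1 = p' * v$2 + q' * w$2"
    by (auto simp: int_lattice_iff)
  \<comment> \<open>The coefficient matrix times the matrix of generators is the identity; take
    determinants.\<close>
  then have "?D * (p * q' - q * p') = 1" by algebra
  then show "\<bar>?D\<bar> = 1" by (metis abs_one abs_zmult_eq_1)
next
  assume "\<bar>?D\<bar> = 1"
  then have D: "?D * ?D = 1" by (metis abs_mult_self_eq mult_1)
  have "u \<in> int_lattice v w" for u
  proof -
    \<comment> \<open>Cramer's rule, with multiplication by \<open>?D\<close> in place of division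
      by it.\<close>
    let ?p = "?D * (u$1 * w$2 - u$2 * w$1)" and ?q = "?D * (v$1 * u$2 - v$2 * u$1)"
    have "u$1 = ?p * v$1 + ?q * w$1" "u$2 = ?p * v$2 + ?q * w$2"
      using D by algebra+
    then show ?thesis unfolding int_lattice_iff by blast
  qed
  then show "int_lattice v w = UNIV" by blast
qed

lemma det_orbit_pair:
  "(vector [x, y] :: int^2)$1 * (M *v vector [x, y])$2
     - (vector [x, y] :: int^2)$2 * (M *v vector [x, y])$1 = - quad_form M y (- x)"
  by (simp add: matrix_vector_mult_def sum_2 quad_form_def algebra_simps power2_eq_square)

text \<open>This follows the Hermite normal form. With g the gcd of the first coordinates of the
  generators and e = |D| / g, first coordinates of lattice points are multiples of g, and points of
  one column differ by multiples of e. Hence there are at most N/g columns in the square, each with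
  at most N/e points. As D divides N, both quotients are exact.\<close>

lemma card_int_lattice_square_le:
  fixes v w :: "int^2" and N :: int
  defines "D \<equiv> v$1 * w$2 - v$2 * w$1"
  assumes "D \<noteq> 0" "D dvd N" "N > 0"
  shows "\<bar>D\<bar> * int (card {z \<in> {0..<N} \<times> {0..<N}. vector [fst z, snd z] \<in> int_lattice v w})
           \<le> N\<^sup>2"
    (is "_ * int (card ?S) \<le> _")
proof -
  define g where "g = gcd (v$1) (w$1)"
  have g: "g > 0"
    using \<open>D \<noteq> 0\<close> by (auto simp: D_def g_def)
  obtain a b where ab: "v$1 = g * a" "w$1 = g * b"
    unfolding g_def by (metis gcd_dvd1 gcd_dvd2 dvdE)
  obtain r s where "r * v$1 + s * w$1 = g"
    unfolding g_def by (metis bezout_int)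
  then have "g * (r * a + s * b) = g * 1"
    by (simp add: ab algebra_simps)
  then have bez: "r * a + s * b = 1" using g by simp
  define e where "e = \<bar>a * w$2 - b * v$2\<bar>"
  have De: "\<bar>D\<bar> = g * e"
  proof -
    have "D = g * (a * w$2 - b * v$2)" by (simp add: D_def ab algebra_simps)
    with g show ?thesis by (simp add: e_def abs_mult)
  qed
  with \<open>D \<noteq> 0\<close> have e: "e > 0" by (auto simp: e_def)
  obtain c where N: "N = g * e * c"
    using \<open>D dvd N\<close> De by (metis abs_dvd_iff dvdE)
  have c: "c > 0"
    using \<open>N > 0\<close> mult_pos_pos[OF g e] unfolding N by (rule zero_less_mult_pos)
  have first: "g dvd x" if "(x, y) \<in> ?S" for x y
    using that by (auto simp: int_lattice_iff ab algebra_simps)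
  have second: "e dvd y - y'" if "(x, y) \<in> ?S" "(x, y') \<in> ?S" for x y y'
  proof -
    have "vector [x, y] - vector [x, y'] \<in> int_lattice v w"
      using that by (intro int_lattice_diff) auto
    then obtain p q where pq: "0 = p * (g * a) + q * (g * b)"
        and h: "y - y' = p * v$2 + q * w$2"
      by (auto simp: int_lattice_iff ab)
    from pq have "g * (p * a + q * b) = 0" by (simp add: algebra_simps)
    with g have "p * a + q * b = 0" by simp
    \<comment> \<open>The vector (p, q) is orthogonal to the primitive vector (a, b), so it equals m
      * (-b, a), where Bezout gives m = r * q - s * p.\<close>
    with h bez have "y - y' = (a * w$2 - b * v$2) * (r * q - s * p)" by algebra
    then show ?thesis by (simp add: e_def)
  qed
  \<comment> \<open>Cut the square into boxes of width g and height e: by \<open>first\<close> and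
    \<open>second\<close> each box holds at most one point of the lattice.\<close>
  let ?f = "\<lambda>(x, y). (x div g, y div e)"
  have inj: "inj_on ?f ?S"
  proof (rule inj_onI)
    fix z z' assume z: "z \<in> ?S" "z' \<in> ?S" "?f z = ?f z'"
    obtain x y x' y' where zz: "z = (x, y)" "z' = (x', y')" by fastforce
    have S: "(x, y) \<in> ?S" "(x', y') \<in> ?S"
      using z(1,2) unfolding zz .
    have eq: "x div g = x' div g" "y div e = y' div e"
      using z(3) unfolding zz by simp_all
    have "x = x'"
      using first[OF S(1)] first[OF S(2)] eq(1) by (metis dvd_mult_div_cancel)
    moreover from this have "y mod e = y' mod e"
      using second[of x y y'] S by (simp add: mod_eq_dvd_iff)
    then have "y = y'" using eq(2) by (metis mult_div_mod_eq)
    ultimately show "z = z'" by (simp add: zz)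
  qed
  have div_less: "a div n < m" if "0 < n" "a < m * n" for a m n :: int
  proof -
    have "a div n * n \<le> a"
      using that(1) by (simp flip: minus_mod_eq_div_mult)
    with that(2) have "a div n * n < m * n" by linarith
    with that(1) show ?thesis by (simp add: mult_less_cancel_right)
  qed
  \<comment> \<open>The numbers of boxes along the two axes are N/g = e * c and N/e = g * c.\<close>
  have N': "N = e * c * g" "N = g * c * e" by (simp_all add: N)
  have "?f z \<in> {0..<e * c} \<times> {0..<g * c}" if "z \<in> ?S" for z
  proof -
    have "fst z < N" "snd z < N" using that by auto
    then have "fst z div g < e * c" "snd z div e < g * c"
      using N' by (metis div_less[OF g], metis div_less[OF e])
    moreover have "0 \<le> fst z div g" "0 \<le> snd z div e"
      using that g e by (auto simp: pos_imp_zdiv_nonneg_iff)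
    ultimately show ?thesis by (simp add: case_prod_unfold)
  qed
  then have "?f ` ?S \<subseteq> {0..<e * c} \<times> {0..<g * c}" by blast
  with inj have "card ?S \<le> card ({0..<e * c} \<times> {0..<g * c})"
    by (intro card_inj_on_le) auto
  then have "int (card ?S) \<le> int (card ({0..<e * c} \<times> {0..<g * c}))"
    by (simp only: of_nat_le_iff)
  also have "\<dots> = (e * c) * (g * c)"
    using g e c by (simp add: card_cartesian_product)
  finally have "\<bar>D\<bar> * int (card ?S) \<le> (g * e) * ((e * c) * (g * c))"
    using De g e by (simp add: mult_left_mono)
  also have "\<dots> = N\<^sup>2" by (simp add: N power2_eq_square)
  finally show ?thesis .
qed

section \<open>Covering the plane by spans of orbits\<close>

lemma orbit_cover_bound:
  fixes x y :: "nat \<Rightarrow> int"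
  assumes "invertible M"
    and cover: "(\<Union>j\<in>{1..k}. group_closure (matrix_orbit M (vector [x j, y j]))) = UNIV"
  shows "\<exists>s t. (s, t) \<noteq> (0, 0) \<and> \<bar>quad_form M s t\<bar> \<le> int k"
proof (rule ccontr)
  assume "\<not> ?thesis"
  \<comment> \<open>In particular the form vanishes at no nonzero vector, so a nonzero starting
    vector always has a span of nonzero determinant.\<close>
  then have big: "(s, t) \<noteq> (0, 0) \<Longrightarrow> \<bar>quad_form M s t\<bar> \<ge> int k + 1" for s t
    by (metis not_le zless_imp_add1_zle)
  define D where "D j = quad_form M (y j) (- x j)" for j
  define J where "J = {j \<in> {1..k}. (x j, y j) \<noteq> (0, 0)}"
  \<comment> \<open>A common multiple of all the determinants, as the point count requires. The
    factor \<open>int k + 1\<close> makes the square large enough for the zero vectors, whose span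
    is a single point.\<close>
  define N where "N = (int k + 1) * (\<Prod>j\<in>J. \<bar>D j\<bar>)"
  have DJ: "\<bar>D j\<bar> \<ge> int k + 1" if "j \<in> J" for j
    using that big[of "y j" "- x j"] by (auto simp: D_def J_def)
  have "(\<Prod>j\<in>J. \<bar>D j\<bar>) > 0"
    using DJ by (intro prod_pos) force
  then have N: "N \<ge> int k + 1" "N > 0"
    by (simp_all add: N_def)
  define L where "L j = int_lattice (vector [x j, y j]) (M *v vector [x j, y j])" for j
  define S where "S j = {z \<in> {0..<N} \<times> {0..<N}. vector [fst z, snd z] \<in> L j}" for j
  have S: "(int k + 1) * int (card (S j)) \<le> N\<^sup>2" if j: "j \<in> {1..k}" for j
  proof (cases "j \<in> J")
    case True
    have "\<bar>D j\<bar> dvd N"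
      unfolding N_def J_def using True
      by (intro dvd_mult dvd_prodI) (auto simp: J_def)
    then have "\<bar>D j\<bar> * int (card (S j)) \<le> N\<^sup>2"
      using card_int_lattice_square_le[of "vector [x j, y j]" "M *v vector [x j, y j]" N]
        DJ[OF True] N
      unfolding det_orbit_pair S_def L_def by (auto simp: D_def)
    with DJ[OF True] show ?thesis
      by (meson mult_right_mono of_nat_0_le_iff order_trans)
  next
    case False
    with j have "x j = 0" "y j = 0" by (auto simp: J_def)
    then have "S j \<subseteq> {(0, 0)}"
      by (auto simp: S_def L_def int_lattice_iff matrix_vector_mult_def sum_2)
    then have "card (S j) \<le> 1"
      using card_mono[of "{(0, 0)}" "S j"] by simp
    then have "(int k + 1) * int (card (S j)) \<le> (int k + 1) * 1"
      by (intro mult_left_mono) auto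
    also have "\<dots> \<le> N" using N by simp
    also have "\<dots> \<le> N\<^sup>2" using N by (simp add: power2_eq_square)
    finally show ?thesis .
  qed
  have "{0..<N} \<times> {0..<N} \<subseteq> (\<Union>j\<in>{1..k}. S j)"
    using cover by (auto simp: S_def L_def group_closure_matrix_orbit[OF assms(1)])
  then have "card ({0..<N} \<times> {0..<N}) \<le> card (\<Union>j\<in>{1..k}. S j)"
    by (intro card_mono) (auto simp: S_def)
  also have "\<dots> \<le> (\<Sum>j\<in>{1..k}. card (S j))"
    by (intro card_UN_le) simp
  finally have "int (card ({0..<N} \<times> {0..<N})) \<le> int (\<Sum>j\<in>{1..k}. card (S j))"
    by (simp only: of_nat_le_iff)
  then have "N\<^sup>2 \<le> (\<Sum>j\<in>{1..k}. int (card (S j)))"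
    using N by (simp add: card_cartesian_product power2_eq_square)
  \<comment> \<open>Each of the k spans takes at most the fraction 1/(k+1) of the square, so summing
    leaves (k+1) * N^2 bounded by k * N^2.\<close>
  then have "(int k + 1) * N\<^sup>2 \<le> (\<Sum>j\<in>{1..k}. (int k + 1) * int (card (S j)))"
    by (simp add: sum_distrib_left[symmetric])
  also have "\<dots> \<le> (\<Sum>j\<in>{1..k}. N\<^sup>2)"
    by (rule sum_mono) (rule S)
  finally have "N\<^sup>2 \<le> 0" by (simp add: algebra_simps)
  with N show False by simp
qed

theorem theoremA7:
  fixes M :: "int^2^2"
  assumes "invertible M"
  shows "(\<forall>x y :: int. group_closure (matrix_orbit M (vector [x, y])) = UNIV \<longleftrightarrow>
            quad_form M y (- x) = 1 \<or> quad_form M y (- x) = - 1) \<and>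
         orbit_covering_number M \<ge>
           Inf {enat (nat \<bar>quad_form M x y\<bar>) | x y :: int. (x, y) \<noteq> (0, 0)}"
proof (intro conjI allI)
  show "group_closure (matrix_orbit M (vector [x, y])) = UNIV \<longleftrightarrow>
      quad_form M y (- x) = 1 \<or> quad_form M y (- x) = - 1" for x y
    unfolding group_closure_matrix_orbit[OF assms] int_lattice_eq_UNIV_iff det_orbit_pair
    by auto
  show "Inf {enat (nat \<bar>quad_form M x y\<bar>) | x y :: int. (x, y) \<noteq> (0, 0)}
      \<le> orbit_covering_number M"
    unfolding orbit_covering_number_def
  \<comment> \<open>If no finite cover exists, the set of admissible k is empty and nothing is to be
    shown. Otherwise every admissible k dominates some value of the form at a nonzero
    vector.\<close>
  proof (rule Inf_greatest)
    fix K assume "K \<in> {enat k | k. \<exists>x y :: nat \<Rightarrow> int.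
      (\<Union>j\<in>{1..k}. group_closure (matrix_orbit M (vector [x j, y j]))) = UNIV}"
    then obtain k x y where K: "K = enat k"
      and cover: "(\<Union>j\<in>{1..k}. group_closure (matrix_orbit M (vector [x j, y j]))) = UNIV"
      by (elim CollectE exE conjE)
    obtain s t where st: "(s, t) \<noteq> (0, 0)" "\<bar>quad_form M s t\<bar> \<le> int k"
      using orbit_cover_bound[OF assms cover] by blast
    have "Inf {enat (nat \<bar>quad_form M x y\<bar>) | x y :: int. (x, y) \<noteq> (0, 0)}
        \<le> enat (nat \<bar>quad_form M s t\<bar>)"
      using st(1) by (intro Inf_lower CollectI exI[of _ s] exI[of _ t] conjI refl)
    also have "\<dots> \<le> K" using st(2) by (simp add: K)
    finally show "Inf {enat (nat \<bar>quad_form M x y\<bar>) | x y :: int. (x, y) \<noteq> (0, 0)}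
        \<le> K" .
  qed
qed

end
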